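(* Let $\mathcal{P}$ be a program, let $\mathcal{C}$ be a program component of $\mathcal{P}$ with entry transitions $\mathcal{E}_{\mathcal{C}}$, and let $(t_{\mathrm{exit}}, \varphi)$ be an assertion such that $t_{\mathrm{exit}} = (\tilde\ell_{\mathrm{exit}}, \tau_{\mathrm{exit}}, \ell_{\mathrm{exit}})$ is an exit transition of $\mathcal{C}$ and $\varphi$ is a clause (a disjunction of linear inequalities over the program variables). If the procedure call $\mathsf{CondSafe}(\mathcal{C}, \mathcal{E}_{\mathcal{C}}, (t_{\mathrm{exit}}, \varphi))$ returns $\mathcal{Q} \neq \mathsf{None}$, then $\mathcal{Q}$ is a conditional inductive invariant for $\mathcal{C}$, and for every entry transition $t = (\ell, \tau, \ell') \in \mathcal{E}_{\mathcal{C}}$ the program $\mathcal{P}$ is $(t, \mathcal{Q}(\ell'))$-conditionally safe for the assertion $(t_{\mathrm{exit}}, \varphi)$.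
   Context: Programs. Fix integer program variables $\mathcal{V} = \{v_1,\dots,v_n\}$ and primed copies $\mathcal{V}' = \{v_1',\dots,v_n'\}$ (values after a step); for a formula $\psi$ over $\mathcal{V}$, $\psi'$ denotes the same formula over $\mathcal{V}'$. Let $\mathcal{L}$ be a finite set of locations containing a start location $\ell_0$. A transition is a triple $(\ell, \tau, \ell')$ with $\ell,\ell' \in \mathcal{L}$ and $\tau$ a conjunction of linear inequalities over $\mathcal{V} \cup \mathcal{V}'$; a program $\mathcal{P}$ is a finite set of transitions, viewed as a directed multigraph (control-flow graph) on $\mathcal{L}$. A state is $(\ell, \vec v)$ with $\ell \in \mathcal{L}$ and $\vec v : \mathcal{V} \to \mathbb{Z}$; an evaluation step $(\ell,\vec v) \to_t (\ell',\vec v')$ with $t = (\ell,\tau,\ell')$ means that $(\vec v, \vec v')$ satisfies $\tau$; $\to_{\mathcal{P}}$ is a step with any transition of $\mathcal{P}$ and $\to^*_{\mathcal{P}}$ its reflexive-transitive closure. An assertion is a pair $(t,\varphi)$ of a transition and a formula over $\mathcal{V}$. Conditional safety. For transitions $t,\tilde t$ and formulas $\varphi, \tilde\varphi$ over $\mathcal{V}$, $\mathcal{P}$ is $(\tilde t, \tilde\varphi)$-conditionally safe for $(t,\varphi)$ if for every evaluation containing $\to_{\tilde t} (\tilde\ell, \tilde{\vec v}) \to^*_{\mathcal{P}} (\bar\ell, \bar{\vec v}) \to_t (\ell, \vec v)$, $\tilde{\vec v} \models \tilde\varphi$ implies $\vec v \models \varphi$. Components. A program component $\mathcal{C}$ is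 (the set of transitions of) a strongly connected component of the control-flow graph; its entry transitions $\mathcal{E}_{\mathcal{C}}$ are the transitions $(\ell,\tau,\ell') \notin \mathcal{C}$ with $\ell'$ a location of $\mathcal{C}$. A transition $t \notin \mathcal{C}$ whose source location is a location of $\mathcal{C}$ is an exit transition of $\mathcal{C}$. Conditional inductive invariant. A map $\mathcal{Q}$ from locations to conjunctions of linear inequalities over $\mathcal{V}$ is a conditional inductive invariant for $\mathcal{C}$ if for every step $(\ell,\vec v) \to_t (\ell',\vec v')$ with $t \in \mathcal{C}$, $\vec v \models \mathcal{Q}(\ell)$ implies $\vec v' \models \mathcal{Q}(\ell')$. Procedure $\mathsf{CondSafe}(\mathcal{C}, \mathcal{E}_{\mathcal{C}}, (t_{\mathrm{exit}},\varphi))$. For $k = 1, 2, \dots, \mathsf{MAX\_CONJUNCTS}$ (a fixed bound) it does the following. For each location $\ell$ of $\mathcal{C}$ it creates a template $I_{\ell,k} \equiv \bigwedge_{j=1}^k I_{\ell,j,k}$ with $I_{\ell,j,k} \equiv i_{\ell,j} + \sum_{v \in \mathcal{V}} i_{\ell,j,v}\cdot v \le 0$, where the coefficients $i_{\ell,j}, i_{\ell,j,v}$ are fresh unknowns (template variables); $I'_{\ell,k}$ is the same template over the primed variables. It then builds a weighted Max-SMT problem over the template variables whose hard constraints are: (Consecution) for each $t = (\ell,\tau,\ell') \in \mathcal{C}$, $I_{\ell,k} \wedge \tau \Rightarrow I'_{\ell',k}$ holds for all values of $\mathcal{V}\cup\mathcal{V}'$; (Safety) $I_{\tilde\ell_{\mathrm{exit}},k}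 \wedge \tau_{\mathrm{exit}} \Rightarrow \varphi'$ holds for all values of $\mathcal{V}\cup\mathcal{V}'$; and whose soft constraints are (Initiation) for each $t = (\ell,\tau,\ell') \in \mathcal{E}_{\mathcal{C}}$ and $1\le j\le k$, $\tau \Rightarrow I'_{\ell',j,k}$. If a solver returns an assignment $\sigma$ of the template variables satisfying all hard constraints, the procedure returns $\mathcal{Q} = \{\ell \mapsto \sigma(I_{\ell,k}) \mid \ell \text{ a location of } \mathcal{C}\}$; otherwise it proceeds with $k+1$. If no $k \le \mathsf{MAX\_CONJUNCTS}$ succeeds, it returns $\mathsf{None}$. *)

theory Defs
  imports Complex_Main "HOL-Library.Multiset" "Graph_Theory.Digraph_Component"
begin

text \<open>
  Program variables are the elements of a finite type \<open>'v\<close>; they range over the integers.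
  Coefficients live in an arbitrary ordered integral domain \<open>'c\<close>, so that integer, rational and
  real coefficients are all covered.  \<open>LessEq c a\<close> stands for \<open>c + (\<Sum>x. a x * x) \<le> 0\<close> and
  \<open>Less c a\<close> for \<open>c + (\<Sum>x. a x * x) < 0\<close>.
\<close>

datatype ('c, 'x) lin_ineq =
    LessEq 'c "'x \<Rightarrow> 'c"
  | Less 'c "'x \<Rightarrow> 'c"

fun ineq_holds :: "('c::linordered_idom, 'x::finite) lin_ineq \<Rightarrow> ('x \<Rightarrow> int) \<Rightarrow> bool" where
  "ineq_holds (LessEq c a) \<nu> \<longleftrightarrow> c + (\<Sum>x\<in>UNIV. a x * of_int (\<nu> x)) \<le> 0"
| "ineq_holds (Less c a) \<nu> \<longleftrightarrow> c + (\<Sum>x\<in>UNIV. a x * of_int (\<nu> x)) < 0"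

definition conj_holds :: "('c::linordered_idom, 'x::finite) lin_ineq list \<Rightarrow> ('x \<Rightarrow> int) \<Rightarrow> bool" where
  "conj_holds \<psi>s \<nu> \<longleftrightarrow> (\<forall>\<psi>\<in>set \<psi>s. ineq_holds \<psi> \<nu>)"

definition clause_holds :: "('c::linordered_idom, 'x::finite) lin_ineq list \<Rightarrow> ('x \<Rightarrow> int) \<Rightarrow> bool" where
  "clause_holds \<psi>s \<nu> \<longleftrightarrow> (\<exists>\<psi>\<in>set \<psi>s. ineq_holds \<psi> \<nu>)"

text \<open>A general formula over the program variables is identified with the predicate it denotes.\<close>

type_synonym 'v formula = "('v \<Rightarrow> int) \<Rightarrow> bool"

text \<open>
  The relation of a transition is a conjunction of inequalities over \<open>'v + 'v\<close>: \<open>Inl x\<close> is the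
  variable \<open>x\<close> before the step, \<open>Inr x\<close> its primed copy.  Accordingly, a primed formula \<open>\<psi>'\<close> holds
  for a pair of valuations \<open>(v, v')\<close> iff \<open>\<psi>\<close> holds for \<open>v'\<close>.
\<close>

type_synonym ('l, 'c, 'v) transition = "'l \<times> ('c, 'v + 'v) lin_ineq list \<times> 'l"
type_synonym ('l, 'v) state = "'l \<times> ('v \<Rightarrow> int)"
type_synonym ('l, 'c, 'v) assertion = "('l, 'c, 'v) transition \<times> 'v formula"

abbreviation source :: "('l, 'c, 'v) transition \<Rightarrow> 'l" where
  "source t \<equiv> fst t"

abbreviation relation :: "('l, 'c, 'v) transition \<Rightarrow> ('c, 'v + 'v) lin_ineq list" where
  "relation t \<equiv> fst (snd t)"

abbreviation target :: "('l, 'c, 'v) transition \<Rightarrow> 'l" where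
  "target t \<equiv> snd (snd t)"

definition rel_holds ::
  "('c::linordered_idom, 'v::finite + 'v) lin_ineq list \<Rightarrow> ('v \<Rightarrow> int) \<Rightarrow> ('v \<Rightarrow> int) \<Rightarrow> bool" where
  "rel_holds \<tau> v v' \<longleftrightarrow> conj_holds \<tau> (case_sum v v')"

definition is_program :: "'l set \<Rightarrow> 'l \<Rightarrow> ('l, 'c, 'v) transition set \<Rightarrow> bool" where
  "is_program L l0 P \<longleftrightarrow> finite L \<and> l0 \<in> L \<and> finite P \<and> (\<forall>t\<in>P. source t \<in> L \<and> target t \<in> L)"

definition step ::
  "('l, 'c::linordered_idom, 'v::finite) transition \<Rightarrow> ('l, 'v) state \<Rightarrow> ('l, 'v) state \<Rightarrow> bool" where
  "step t s s' \<longleftrightarrow> fst s = source t \<and> fst s' = target t \<and> rel_holds (relation t) (snd s) (snd s')"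

definition prog_step ::
  "('l, 'c::linordered_idom, 'v::finite) transition set \<Rightarrow> ('l, 'v) state \<Rightarrow> ('l, 'v) state \<Rightarrow> bool" where
  "prog_step P s s' \<longleftrightarrow> (\<exists>t\<in>P. step t s s')"

text \<open>\<open>cond_safe P (t1, \<phi>1) (t, \<phi>)\<close>: \<open>P\<close> is \<open>(t1, \<phi>1)\<close>-conditionally safe for \<open>(t, \<phi>)\<close>.\<close>

definition cond_safe ::
  "('l, 'c::linordered_idom, 'v::finite) transition set
    \<Rightarrow> ('l, 'c, 'v) assertion \<Rightarrow> ('l, 'c, 'v) assertion \<Rightarrow> bool" where
  "cond_safe P = (\<lambda>(t1, \<phi>1) (t, \<phi>).
     \<forall>s0 s1 s2 s3. step t1 s0 s1 \<and> (prog_step P)\<^sup>*\<^sup>* s1 s2 \<and> step t s2 s3 \<longrightarrow>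
       \<phi>1 (snd s1) \<longrightarrow> \<phi> (snd s3))"

definition cfg :: "'l set \<Rightarrow> ('l, 'c, 'v) transition set \<Rightarrow> ('l, ('l, 'c, 'v) transition) pre_digraph" where
  "cfg L P = \<lparr>verts = L, arcs = P, tail = source, head = target\<rparr>"

text \<open>
  A component is kept as a subgraph of the control-flow graph: its transitions are \<open>arcs C\<close> and its
  locations are \<open>verts C\<close>.  This also covers the component consisting of a single location without
  self-loop, which its (empty) set of transitions would not determine.
\<close>

type_synonym ('l, 'c, 'v) component = "('l, ('l, 'c, 'v) transition) pre_digraph"

definition is_component ::
  "'l set \<Rightarrow> ('l, 'c, 'v) transition set \<Rightarrow> ('l, 'c, 'v) component \<Rightarrow> bool" where
  "is_component L P C \<longleftrightarrow> C \<in> pre_digraph.sccs (cfg L P)"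

definition entry_transitions ::
  "('l, 'c, 'v) transition set \<Rightarrow> ('l, 'c, 'v) component \<Rightarrow> ('l, 'c, 'v) transition set" where
  "entry_transitions P C = {t \<in> P. t \<notin> arcs C \<and> target t \<in> verts C}"

definition exit_transitions ::
  "('l, 'c, 'v) transition set \<Rightarrow> ('l, 'c, 'v) component \<Rightarrow> ('l, 'c, 'v) transition set" where
  "exit_transitions P C = {t \<in> P. t \<notin> arcs C \<and> source t \<in> verts C}"

type_synonym ('l, 'c, 'v) loc_map = "'l \<rightharpoonup> ('c, 'v) lin_ineq list"

definition cond_inductive_invariant ::
  "('l, 'c::linordered_idom, 'v::finite) component \<Rightarrow> ('l, 'c, 'v) loc_map \<Rightarrow> bool" where
  "cond_inductive_invariant C Q \<longleftrightarrow>
     verts C \<subseteq> dom Q \<and>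
     (\<forall>t\<in>arcs C. \<forall>s s'. step t s s' \<longrightarrow>
        conj_holds (the (Q (fst s))) (snd s) \<longrightarrow> conj_holds (the (Q (fst s'))) (snd s'))"

text \<open>
  Template variables: \<open>TConst l j\<close> is \<open>i\<^bsub>l,j\<^esub>\<close> and \<open>TCoeff l j x\<close> is \<open>i\<^bsub>l,j,x\<^esub>\<close>.  A template is a linear
  inequality whose coefficients are template variables; \<open>map_lin_ineq \<sigma>\<close> instantiates it.
\<close>

datatype ('l, 'v) tvar = TConst 'l nat | TCoeff 'l nat 'v

definition template_ineq :: "'l \<Rightarrow> nat \<Rightarrow> (('l, 'v) tvar, 'v) lin_ineq" where
  "template_ineq l j = LessEq (TConst l j) (TCoeff l j)"

definition template :: "nat \<Rightarrow> 'l \<Rightarrow> (('l, 'v) tvar, 'v) lin_ineq list" where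
  "template k l = map (template_ineq l) [1..<Suc k]"

definition inst :: "('x \<Rightarrow> 'c) \<Rightarrow> ('x, 'v) lin_ineq list \<Rightarrow> ('c, 'v) lin_ineq list" where
  "inst \<sigma> = map (map_lin_ineq \<sigma>)"

text \<open>
  A weighted Max-SMT problem over unknowns \<open>'x\<close> with values in \<open>'c\<close>.  A constraint is given by the set
  of assignments that satisfy it; soft constraints carry a weight and may occur repeatedly.
\<close>

type_synonym ('x, 'c) smt_constraint = "('x \<Rightarrow> 'c) \<Rightarrow> bool"

record ('x, 'c) max_smt =
  hard :: "('x, 'c) smt_constraint set"
  soft :: "(('x, 'c) smt_constraint \<times> real) multiset"

definition satisfies_hard :: "('x \<Rightarrow> 'c) \<Rightarrow> ('x, 'c) max_smt \<Rightarrow> bool" where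
  "satisfies_hard \<sigma> M \<longleftrightarrow> (\<forall>\<chi>\<in>hard M. \<chi> \<sigma>)"

definition consecution ::
  "nat \<Rightarrow> ('l, 'c::linordered_idom, 'v::finite) transition \<Rightarrow> (('l, 'v) tvar, 'c) smt_constraint" where
  "consecution k t = (\<lambda>\<sigma>. \<forall>v v'.
     conj_holds (inst \<sigma> (template k (source t))) v \<and> rel_holds (relation t) v v' \<longrightarrow>
     conj_holds (inst \<sigma> (template k (target t))) v')"

definition safety ::
  "nat \<Rightarrow> ('l, 'c::linordered_idom, 'v::finite) assertion \<Rightarrow> (('l, 'v) tvar, 'c) smt_constraint" where
  "safety k = (\<lambda>(t, \<phi>) \<sigma>. \<forall>v v'.
     conj_holds (inst \<sigma> (template k (source t))) v \<and> rel_holds (relation t) v v' \<longrightarrow> \<phi> v')"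

definition initiation ::
  "('l, 'c::linordered_idom, 'v::finite) transition \<Rightarrow> nat \<Rightarrow> (('l, 'v) tvar, 'c) smt_constraint" where
  "initiation t j = (\<lambda>\<sigma>. \<forall>v v'.
     rel_holds (relation t) v v' \<longrightarrow> ineq_holds (map_lin_ineq \<sigma> (template_ineq (target t) j)) v')"

definition cond_safe_problem ::
  "(('l, 'c::linordered_idom, 'v::finite) transition \<Rightarrow> nat \<Rightarrow> real) \<Rightarrow> ('l, 'c, 'v) component
    \<Rightarrow> ('l, 'c, 'v) transition set \<Rightarrow> ('l, 'c, 'v) assertion \<Rightarrow> nat \<Rightarrow> (('l, 'v) tvar, 'c) max_smt" where
  "cond_safe_problem w C E a k = \<lparr>
     hard = consecution k ` arcs C \<union> {safety k a},
     soft = image_mset (\<lambda>(t, j). (initiation t j, w t j)) (mset_set (E \<times> {1..k}))\<rparr>"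

text \<open>
  The solver is an arbitrary function that may give up, need not be optimal for the soft constraints
  and is not trusted: the procedure only accepts an assignment satisfying all hard constraints.
\<close>

type_synonym ('x, 'c) max_smt_solver = "('x, 'c) max_smt \<Rightarrow> ('x \<Rightarrow> 'c) option"

definition cond_safe_attempt ::
  "(('l, 'v) tvar, 'c) max_smt_solver \<Rightarrow> (('l, 'c::linordered_idom, 'v::finite) transition \<Rightarrow> nat \<Rightarrow> real)
    \<Rightarrow> ('l, 'c, 'v) component \<Rightarrow> ('l, 'c, 'v) transition set \<Rightarrow> ('l, 'c, 'v) assertion \<Rightarrow> nat
    \<Rightarrow> ('l, 'c, 'v) loc_map option" where
  "cond_safe_attempt solver w C E a k =
     (case solver (cond_safe_problem w C E a k) of
        None \<Rightarrow> None
      | Some \<sigma> \<Rightarrow>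
          if satisfies_hard \<sigma> (cond_safe_problem w C E a k)
          then Some (\<lambda>l. if l \<in> verts C then Some (inst \<sigma> (template k l)) else None)
          else None)"

fun first_success :: "('k \<Rightarrow> 'r option) \<Rightarrow> 'k list \<Rightarrow> 'r option" where
  "first_success f [] = None"
| "first_success f (k # ks) = (case f k of Some r \<Rightarrow> Some r | None \<Rightarrow> first_success f ks)"

definition CondSafe ::
  "(('l, 'v) tvar, 'c) max_smt_solver \<Rightarrow> (('l, 'c::linordered_idom, 'v::finite) transition \<Rightarrow> nat \<Rightarrow> real)
    \<Rightarrow> nat \<Rightarrow> ('l, 'c, 'v) component \<Rightarrow> ('l, 'c, 'v) transition set \<Rightarrow> ('l, 'c, 'v) assertion
    \<Rightarrow> ('l, 'c, 'v) loc_map option" where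
  "CondSafe solver w max_conjuncts C E a =
     first_success (cond_safe_attempt solver w C E a) [1..<Suc max_conjuncts]"

end

theory Submission
  imports Defs
begin

text \<open>
  A run from the entry transition to the exit transition starts and ends in the component; by
  maximality of strongly connected components it never leaves it in between. All its steps thus
  use transitions of the component, so consecution carries \<open>Q\<close> along the run up to the source of
  the exit transition, where safety applies.
\<close>

lemma first_success_SomeD:
  assumes "first_success f ks = Some r"
  shows "\<exists>k\<in>set ks. f k = Some r"
  using assms by (induction ks) (auto split: option.splits)

lemma wf_digraph_cfg:
  assumes "is_program L l0 P"
  shows "wf_digraph (cfg L P)"
  using assms by unfold_locales (auto simp: is_program_def cfg_def)

lemma prog_step_dominates:
  assumes "is_program L l0 P" and "prog_step P s s'"
  shows "fst s \<rightarrow>\<^bsub>cfg L P\<^esub> fst s'"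
proof -
  obtain t where t: "t \<in> P" "fst s = source t" "fst s' = target t"
    using assms(2) by (auto simp: prog_step_def step_def)
  then have "t \<in> arcs (cfg L P)"
    by (simp add: cfg_def)
  from wf_digraph.in_arcs_imp_in_arcs_ends[OF wf_digraph_cfg[OF assms(1)] this] t
  show ?thesis by (simp add: cfg_def)
qed

text \<open>Forgetting valuations projects a run to a walk in the control-flow graph. The premise
  \<open>fst s' \<in> L\<close> serves the empty run, since reachability is reflexive only at
  vertices of the graph.\<close>

lemma prog_steps_reachable:
  assumes prog: "is_program L l0 P"
    and "(prog_step P)\<^sup>*\<^sup>* s s'" and "fst s' \<in> L"
  shows "fst s \<rightarrow>\<^sup>*\<^bsub>cfg L P\<^esub> fst s'"
  using assms(2)
proof (induction rule: converse_rtranclp_induct)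
  case base
  interpret wf_digraph "cfg L P" using prog by (rule wf_digraph_cfg)
  have "fst s' \<in> verts (cfg L P)" using assms(3) by (simp add: cfg_def)
  then show ?case by (rule reachable_refl)
next
  case (step s u)
  interpret wf_digraph "cfg L P" using prog by (rule wf_digraph_cfg)
  show ?case
    using prog_step_dominates[OF prog step(1)] step(3) by (rule adj_reachable_trans)
qed

lemma component_locations:
  assumes "is_program L l0 P" and "is_component L P C"
  shows "verts C \<in> pre_digraph.sccs_verts (cfg L P)"
  using wf_digraph.in_sccs_vertsI_sccs[OF wf_digraph_cfg[OF assms(1)]] assms(2)
  by (simp add: is_component_def)

text \<open>Strongly connected components are induced subgraphs, so membership of a transition is
  decided by its two end locations alone.\<close>

lemma component_arcs:
  assumes "is_component L P C"
  shows "arcs C = {t \<in> P. source t \<in> verts C \<and> target t \<in> verts C}"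
proof -
  have "induced_subgraph C (cfg L P)"
    using assms unfolding is_component_def by (rule pre_digraph.in_sccs_imp_induced)
  then show ?thesis by (auto simp: induced_subgraph_def cfg_def)
qed

lemma cond_inductive_invariant_steps:
  assumes prog: "is_program L l0 P" and comp: "is_component L P C"
    and inv: "cond_inductive_invariant C Q"
    and run: "(prog_step P)\<^sup>*\<^sup>* s1 s2"
    and start: "fst s1 \<in> verts C" and final: "fst s2 \<in> verts C"
    and "conj_holds (the (Q (fst s1))) (snd s1)"
  shows "conj_holds (the (Q (fst s2))) (snd s2)"
  using run start assms(7)
\<comment> \<open>Steps are peeled off at the front while \<open>s2\<close> stays fixed: the rest of
  the run is then still available to lead from the new state back into the component.\<close>
proof (induction rule: converse_rtranclp_induct)
  case base
  then show ?case by simp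
next
  case (step s u)
  interpret wf_digraph "cfg L P" using prog by (rule wf_digraph_cfg)
  have scc: "verts C \<in> sccs_verts"
    using prog comp by (rule component_locations)
  have "fst s2 \<in> L"
    using sccs_verts_subsets[OF scc] final by (auto simp: cfg_def)
  with prog step(2) have "fst u \<rightarrow>\<^sup>*\<^bsub>cfg L P\<^esub> fst s2"
    by (rule prog_steps_reachable)
  \<comment> \<open>Strong connectedness closes the cycle: both \<open>fst s2\<close> and
    \<open>fst s\<close> lie in \<open>C\<close>.\<close>
  moreover have "fst s2 \<rightarrow>\<^sup>*\<^bsub>cfg L P\<^esub> fst s"
    using scc final step.prems unfolding in_sccs_verts_conv_reachable by blast
  ultimately have "fst u \<rightarrow>\<^sup>*\<^bsub>cfg L P\<^esub> fst s"
    by (rule reachable_trans)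
  moreover have "fst s \<rightarrow>\<^sup>*\<^bsub>cfg L P\<^esub> fst u"
    using prog_step_dominates[OF prog step(1)] by (rule reachable_adjI)
  \<comment> \<open>\<open>fst u\<close> and \<open>fst s\<close> reach each other, so maximality of
    the component puts \<open>fst u\<close> inside.\<close>
  ultimately have u: "fst u \<in> verts C"
    using scc step.prems unfolding in_sccs_verts_conv_reachable by blast
  obtain t where t: "t \<in> P" "Defs.step t s u"
    using step(1) by (auto simp: prog_step_def)
  with u step.prems have "t \<in> arcs C"
    by (simp add: component_arcs[OF comp] step_def)
  with inv t step.prems have "conj_holds (the (Q (fst u))) (snd u)"
    unfolding cond_inductive_invariant_def by blast
  with u show ?case by (rule step.IH)
qed

text \<open>The guarantees come from the test \<open>satisfies_hard\<close> in the accepting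
  attempt, not from trust in the solver.\<close>

lemma CondSafe_SomeE:
  assumes "CondSafe solver w n C E a = Some Q"
  obtains k \<sigma> where
    "\<And>l. Q l = (if l \<in> verts C then Some (inst \<sigma> (template k l)) else None)"
    and "\<And>t. t \<in> arcs C \<Longrightarrow> consecution k t \<sigma>"
    and "safety k a \<sigma>"
proof -
  obtain k where "cond_safe_attempt solver w C E a k = Some Q"
    using first_success_SomeD[OF assms[unfolded CondSafe_def]] by blast
  then obtain \<sigma> where
    "satisfies_hard \<sigma> (cond_safe_problem w C E a k)"
    "Q = (\<lambda>l. if l \<in> verts C then Some (inst \<sigma> (template k l)) else None)"
    by (auto simp: cond_safe_attempt_def split: option.splits if_splits)
  then show ?thesis
    by (intro that[of \<sigma> k]) (simp_all add: satisfies_hard_def cond_safe_problem_def)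
qed

theorem theorem1:
  fixes L :: "'l set" and l0 :: 'l
    and P :: "('l, 'c::linordered_idom, 'v::finite) transition set"
    and C :: "('l, 'c, 'v) component"
    and t_exit :: "('l, 'c, 'v) transition"
    and \<phi> :: "('c, 'v) lin_ineq list"
    and solver :: "(('l, 'v) tvar, 'c) max_smt_solver"
    and w :: "('l, 'c, 'v) transition \<Rightarrow> nat \<Rightarrow> real"
    and max_conjuncts :: nat
    and Q :: "('l, 'c, 'v) loc_map"
  assumes "is_program L l0 P"
    and "is_component L P C"
    and "t_exit \<in> exit_transitions P C"
    and "CondSafe solver w max_conjuncts C (entry_transitions P C) (t_exit, clause_holds \<phi>) = Some Q"
  shows "cond_inductive_invariant C Q \<and>
    (\<forall>t\<in>entry_transitions P C.
       cond_safe P (t, conj_holds (the (Q (target t)))) (t_exit, clause_holds \<phi>))"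
proof (intro conjI ballI)
  obtain k \<sigma> where
    Q: "\<And>l. Q l = (if l \<in> verts C then Some (inst \<sigma> (template k l)) else None)"
    and consec: "\<And>t. t \<in> arcs C \<Longrightarrow> consecution k t \<sigma>"
    and safe: "safety k (t_exit, clause_holds \<phi>) \<sigma>"
    by (rule CondSafe_SomeE[OF assms(4)]) (rule that)
  have "conj_holds (the (Q (fst s'))) (snd s')"
    if "t \<in> arcs C" "step t s s'" "conj_holds (the (Q (fst s))) (snd s)" for t s s'
  proof -
    \<comment> \<open>Only at locations of \<open>C\<close> does \<open>the (Q l)\<close> unfold to
      the instantiated template, so both ends of \<open>t\<close> must be located first.\<close>
    from that(1) have "source t \<in> verts C" "target t \<in> verts C"
      by (auto simp: component_arcs[OF assms(2)])
    with that(2,3) have "conj_holds (inst \<sigma> (template k (source t))) (snd s)"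
      "rel_holds (relation t) (snd s) (snd s')"
      by (simp_all add: Q step_def)
    with consec[OF that(1)] have "conj_holds (inst \<sigma> (template k (target t))) (snd s')"
      unfolding consecution_def by blast
    with \<open>target t \<in> verts C\<close> that(2) show ?thesis
      by (simp add: Q step_def)
  qed
  \<comment> \<open>The \<open>domI\<close> rule handles \<open>verts C \<subseteq> dom Q\<close>:
    on these locations the conditional describing \<open>Q\<close> takes its \<open>Some\<close>
    branch.\<close>
  then show inv: "cond_inductive_invariant C Q"
    unfolding cond_inductive_invariant_def by (blast intro: domI Q[THEN trans, OF if_P])
  fix t assume t: "t \<in> entry_transitions P C"
  have "clause_holds \<phi> (snd s3)"
    if "step t s0 s1" "(prog_step P)\<^sup>*\<^sup>* s1 s2" "step t_exit s2 s3"
      and "conj_holds (the (Q (target t))) (snd s1)" for s0 s1 s2 s3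
  proof -
    \<comment> \<open>Entry transitions end in \<open>C\<close> and exit transitions start there,
      which places both ends of the intermediate run in the component.\<close>
    have s1: "fst s1 = target t" "fst s1 \<in> verts C"
      using t that(1) by (auto simp: entry_transitions_def step_def)
    have s2: "fst s2 = source t_exit" "fst s2 \<in> verts C"
      using assms(3) that(3) by (auto simp: exit_transitions_def step_def)
    have "conj_holds (the (Q (fst s2))) (snd s2)"
      using cond_inductive_invariant_steps[OF assms(1,2) inv that(2) s1(2) s2(2)] that(4) s1(1)
      by simp
    with s2 have "conj_holds (inst \<sigma> (template k (source t_exit))) (snd s2)"
      by (simp add: Q)
    moreover have "rel_holds (relation t_exit) (snd s2) (snd s3)"
      using that(3) by (simp add: step_def)
    ultimately show ?thesis
      using safe unfolding safety_def prod.case by blast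
  qed
  then show "cond_safe P (t, conj_holds (the (Q (target t)))) (t_exit, clause_holds \<phi>)"
    unfolding cond_safe_def prod.case by blast
qed

end
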